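(* In constructive Euclidean field theory (with intuitionistic logic), the following formulas are not provable: (i) "two-sides": $x\neq 0\to x>0\vee x<0$; (ii) $x\le 0\vee 0\le x$; (iii) "apartness": $0<x\vee x<1$.
   Context: Constructive Euclidean field theory is the theory, with intuitionistic first-order logic, in the language of commutative rings ($0,1,+,\cdot,-$) with a unary predicate $P(x)$ ("$x$ is positive"), whose axioms are the commutative ring axioms together with: stability of equality: $\neg x\neq y\to x=y$; EF0: $0\neq 1$; EF1: $x\neq 0\to\exists y\,(x\cdot y=1)$; EF2: $P(x)\wedge P(y)\to P(x+y)\wedge P(x\cdot y)$; EF3: $x+y=0\to\neg(P(x)\wedge P(y))$; EF4: $x+y=0\wedge\neg P(x)\wedge\neg P(y)\to x=0$; EF5: $x+y=0\wedge\neg P(y)\to\exists z\,(z\cdot z=x)$; EF6 (Markov's principle): $\neg\neg P(x)\to P(x)$. Here $x<y$ abbreviates $\exists z\,(P(z)\wedge x+z=y)$ (i.e. $P(y-x)$), and $x\le y$ abbreviates $\neg(y<x)$. *)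

theory Defs
  imports Main
begin

text \<open>
  Terms and formulas of the language of commutative rings with a unary predicate for positivity.
  Variables are de Bruijn indices: under a quantifier, \<open>V 0\<close> is the variable bound
  by the innermost quantifier.
\<close>

datatype tm =
    V nat
  | Zero ("\<^bold>0")
  | One ("\<^bold>1")
  | Plus tm tm (infixl "\<^bold>+" 65)
  | Times tm tm (infixl "\<^bold>*" 70)
  | Minus tm ("\<^bold>- _" [81] 80)

datatype fm =
    Eq tm tm (infix "\<^bold>=" 50)
  | Pos tm
  | Falsum ("\<^bold>\<bottom>")
  | Conj fm fm (infixr "\<^bold>\<and>" 35)
  | Disj fm fm (infixr "\<^bold>\<or>" 30)
  | Impl fm fm (infixr "\<^bold>\<longrightarrow>" 25)
  | Forall fm
  | Exists fm

text \<open>Simultaneous substitution of terms for all variables.\<close>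

primrec subst_tm :: "tm \<Rightarrow> (nat \<Rightarrow> tm) \<Rightarrow> tm" where
  "subst_tm (V n) \<sigma> = \<sigma> n"
| "subst_tm \<^bold>0 \<sigma> = \<^bold>0"
| "subst_tm \<^bold>1 \<sigma> = \<^bold>1"
| "subst_tm (s \<^bold>+ t) \<sigma> = subst_tm s \<sigma> \<^bold>+ subst_tm t \<sigma>"
| "subst_tm (s \<^bold>* t) \<sigma> = subst_tm s \<sigma> \<^bold>* subst_tm t \<sigma>"
| "subst_tm (\<^bold>- t) \<sigma> = \<^bold>- subst_tm t \<sigma>"

definition lift_tm :: "tm \<Rightarrow> tm" where
  "lift_tm t = subst_tm t (\<lambda>n. V (Suc n))"

definition under_binder :: "(nat \<Rightarrow> tm) \<Rightarrow> nat \<Rightarrow> tm" where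
  "under_binder \<sigma> n = (case n of 0 \<Rightarrow> V 0 | Suc k \<Rightarrow> lift_tm (\<sigma> k))"

primrec subst_fm :: "fm \<Rightarrow> (nat \<Rightarrow> tm) \<Rightarrow> fm" where
  "subst_fm (s \<^bold>= t) \<sigma> = (subst_tm s \<sigma> \<^bold>= subst_tm t \<sigma>)"
| "subst_fm (Pos t) \<sigma> = Pos (subst_tm t \<sigma>)"
| "subst_fm \<^bold>\<bottom> \<sigma> = \<^bold>\<bottom>"
| "subst_fm (\<phi> \<^bold>\<and> \<psi>) \<sigma> = (subst_fm \<phi> \<sigma> \<^bold>\<and> subst_fm \<psi> \<sigma>)"
| "subst_fm (\<phi> \<^bold>\<or> \<psi>) \<sigma> = (subst_fm \<phi> \<sigma> \<^bold>\<or> subst_fm \<psi> \<sigma>)"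
| "subst_fm (\<phi> \<^bold>\<longrightarrow> \<psi>) \<sigma> = (subst_fm \<phi> \<sigma> \<^bold>\<longrightarrow> subst_fm \<psi> \<sigma>)"
| "subst_fm (Forall \<phi>) \<sigma> = Forall (subst_fm \<phi> (under_binder \<sigma>))"
| "subst_fm (Exists \<phi>) \<sigma> = Exists (subst_fm \<phi> (under_binder \<sigma>))"

definition lift_fm :: "fm \<Rightarrow> fm" where
  "lift_fm \<phi> = subst_fm \<phi> (\<lambda>n. V (Suc n))"

text \<open>Instantiation of the outermost variable \<open>V 0\<close>; the remaining variables move down by one.\<close>

definition inst :: "fm \<Rightarrow> tm \<Rightarrow> fm" where
  "inst \<phi> t = subst_fm \<phi> (\<lambda>n. case n of 0 \<Rightarrow> t | Suc k \<Rightarrow> V k)"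

text \<open>
  Natural deduction for intuitionistic first-order logic with equality. Lifting the context in
  \<open>ForallI\<close> and \<open>ExistsE\<close> expresses the eigenvariable condition.
\<close>

inductive deriv :: "fm set \<Rightarrow> fm \<Rightarrow> bool" (infix "\<turnstile>" 20) where
  Assm: "\<phi> \<in> \<Gamma> \<Longrightarrow> \<Gamma> \<turnstile> \<phi>"
| FalsumE: "\<Gamma> \<turnstile> \<^bold>\<bottom> \<Longrightarrow> \<Gamma> \<turnstile> \<phi>"
| ConjI: "\<Gamma> \<turnstile> \<phi> \<Longrightarrow> \<Gamma> \<turnstile> \<psi> \<Longrightarrow> \<Gamma> \<turnstile> (\<phi> \<^bold>\<and> \<psi>)"
| ConjE1: "\<Gamma> \<turnstile> (\<phi> \<^bold>\<and> \<psi>) \<Longrightarrow> \<Gamma> \<turnstile> \<phi>"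
| ConjE2: "\<Gamma> \<turnstile> (\<phi> \<^bold>\<and> \<psi>) \<Longrightarrow> \<Gamma> \<turnstile> \<psi>"
| DisjI1: "\<Gamma> \<turnstile> \<phi> \<Longrightarrow> \<Gamma> \<turnstile> (\<phi> \<^bold>\<or> \<psi>)"
| DisjI2: "\<Gamma> \<turnstile> \<psi> \<Longrightarrow> \<Gamma> \<turnstile> (\<phi> \<^bold>\<or> \<psi>)"
| DisjE: "\<Gamma> \<turnstile> (\<phi> \<^bold>\<or> \<psi>) \<Longrightarrow> insert \<phi> \<Gamma> \<turnstile> \<chi> \<Longrightarrow> insert \<psi> \<Gamma> \<turnstile> \<chi> \<Longrightarrow> \<Gamma> \<turnstile> \<chi>"
| ImplI: "insert \<phi> \<Gamma> \<turnstile> \<psi> \<Longrightarrow> \<Gamma> \<turnstile> (\<phi> \<^bold>\<longrightarrow> \<psi>)"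
| ImplE: "\<Gamma> \<turnstile> (\<phi> \<^bold>\<longrightarrow> \<psi>) \<Longrightarrow> \<Gamma> \<turnstile> \<phi> \<Longrightarrow> \<Gamma> \<turnstile> \<psi>"
| ForallI: "lift_fm ` \<Gamma> \<turnstile> \<phi> \<Longrightarrow> \<Gamma> \<turnstile> Forall \<phi>"
| ForallE: "\<Gamma> \<turnstile> Forall \<phi> \<Longrightarrow> \<Gamma> \<turnstile> inst \<phi> t"
| ExistsI: "\<Gamma> \<turnstile> inst \<phi> t \<Longrightarrow> \<Gamma> \<turnstile> Exists \<phi>"
| ExistsE: "\<Gamma> \<turnstile> Exists \<phi> \<Longrightarrow> insert \<phi> (lift_fm ` \<Gamma>) \<turnstile> lift_fm \<chi> \<Longrightarrow> \<Gamma> \<turnstile> \<chi>"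
| EqRefl: "\<Gamma> \<turnstile> (t \<^bold>= t)"
| EqSubst: "\<Gamma> \<turnstile> (s \<^bold>= t) \<Longrightarrow> \<Gamma> \<turnstile> inst \<phi> s \<Longrightarrow> \<Gamma> \<turnstile> inst \<phi> t"

definition Neg :: "fm \<Rightarrow> fm" ("\<^bold>\<not> _" [40] 40) where
  "(\<^bold>\<not> \<phi>) = (\<phi> \<^bold>\<longrightarrow> \<^bold>\<bottom>)"

definition Neq :: "tm \<Rightarrow> tm \<Rightarrow> fm" (infix "\<^bold>\<noteq>" 50) where
  "(s \<^bold>\<noteq> t) = (\<^bold>\<not> (s \<^bold>= t))"

definition Less :: "tm \<Rightarrow> tm \<Rightarrow> fm" (infix "\<^bold><" 50) where
  "(s \<^bold>< t) = Exists (Pos (V 0) \<^bold>\<and> (lift_tm s \<^bold>+ V 0 \<^bold>= lift_tm t))"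

definition LessEq :: "tm \<Rightarrow> tm \<Rightarrow> fm" (infix "\<^bold>\<le>" 50) where
  "(s \<^bold>\<le> t) = (\<^bold>\<not> (t \<^bold>< s))"

definition ring_axioms :: "fm set" where
  "ring_axioms =
    (let x = V 2; y = V 1; z = V 0 in
      {Forall (Forall (Forall ((x \<^bold>+ y) \<^bold>+ z \<^bold>= x \<^bold>+ (y \<^bold>+ z)))),
       Forall (Forall (Forall ((x \<^bold>* y) \<^bold>* z \<^bold>= x \<^bold>* (y \<^bold>* z)))),
       Forall (Forall (Forall (x \<^bold>* (y \<^bold>+ z) \<^bold>= x \<^bold>* y \<^bold>+ x \<^bold>* z)))}) \<union>
    (let x = V 1; y = V 0 in
      {Forall (Forall (x \<^bold>+ y \<^bold>= y \<^bold>+ x)),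
       Forall (Forall (x \<^bold>* y \<^bold>= y \<^bold>* x))}) \<union>
    (let x = V 0 in
      {Forall (x \<^bold>+ \<^bold>0 \<^bold>= x),
       Forall (x \<^bold>+ (\<^bold>- x) \<^bold>= \<^bold>0),
       Forall (x \<^bold>* \<^bold>1 \<^bold>= x)})"

definition stability_eq :: fm where
  "stability_eq = (let x = V 1; y = V 0 in Forall (Forall (\<^bold>\<not> (x \<^bold>\<noteq> y) \<^bold>\<longrightarrow> x \<^bold>= y)))"

definition EF0 :: fm where
  "EF0 = (\<^bold>0 \<^bold>\<noteq> \<^bold>1)"

text \<open>In \<open>EF1\<close> the variable \<open>x\<close> has index 0 outside the existential quantifier and 1 inside.\<close>

definition EF1 :: fm where
  "EF1 = Forall (V 0 \<^bold>\<noteq> \<^bold>0 \<^bold>\<longrightarrow> Exists (V 1 \<^bold>* V 0 \<^bold>= \<^bold>1))"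

definition EF2 :: fm where
  "EF2 = (let x = V 1; y = V 0 in
    Forall (Forall (Pos x \<^bold>\<and> Pos y \<^bold>\<longrightarrow> Pos (x \<^bold>+ y) \<^bold>\<and> Pos (x \<^bold>* y))))"

definition EF3 :: fm where
  "EF3 = (let x = V 1; y = V 0 in
    Forall (Forall (x \<^bold>+ y \<^bold>= \<^bold>0 \<^bold>\<longrightarrow> \<^bold>\<not> (Pos x \<^bold>\<and> Pos y))))"

definition EF4 :: fm where
  "EF4 = (let x = V 1; y = V 0 in
    Forall (Forall (x \<^bold>+ y \<^bold>= \<^bold>0 \<^bold>\<and> \<^bold>\<not> Pos x \<^bold>\<and> \<^bold>\<not> Pos y \<^bold>\<longrightarrow> x \<^bold>= \<^bold>0)))"

text \<open>In \<open>EF5\<close> the variable \<open>x\<close> has index 1 outside the existential quantifier and 2 inside.\<close>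

definition EF5 :: fm where
  "EF5 = Forall (Forall
    (V 1 \<^bold>+ V 0 \<^bold>= \<^bold>0 \<^bold>\<and> \<^bold>\<not> Pos (V 0) \<^bold>\<longrightarrow> Exists (V 0 \<^bold>* V 0 \<^bold>= V 2)))"

definition EF6 :: fm where
  "EF6 = Forall (\<^bold>\<not> (\<^bold>\<not> Pos (V 0)) \<^bold>\<longrightarrow> Pos (V 0))"

definition EF :: "fm set" where
  "EF = ring_axioms \<union> {stability_eq, EF0, EF1, EF2, EF3, EF4, EF5, EF6}"

end

theory Submission
  imports Defs Complex_Main
begin

text \<open>
  The three formulas fail in a Kripke model with one root below a family of leaves. Every leaf is
  the classical ordered field \<open>\<real>\<close>; the root is the product ring of all families
  \<open>'i \<Rightarrow> real\<close>, and the transition map from the root to leaf \<open>i\<close> is the projection to the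
  coordinate \<open>i\<close>. Equality and positivity at the root mean equality and positivity in all
  coordinates.

  The product ring is far from being a field, but the root forces the axioms all the same. A negated
  formula is forced at the root exactly when it holds at all leaves. So the hypothesis of \<open>EF1\<close>
  says that all coordinates are nonzero, and the hypothesis of \<open>EF5\<close> that all coordinates are
  nonnegative; inverses and square roots can then be taken coordinatewise. The remaining axioms
  contain neither disjunctions nor existential quantifiers; their equations, positivity statements
  and negations are all read coordinatewise, so they hold because they hold in \<open>\<real>\<close> (this includes
  stability of equality and Markov's principle).

  A disjunction, in contrast, needs one disjunct forced at the root, hence true in all coordinates
  at once. A family with one positive and one negative coordinate is forced to be nonzero, but none
  of \<open>0 < x\<close>, \<open>x < 0\<close>, \<open>x \<le> 0\<close> and \<open>0 \<le> x\<close> is forced; for apartness, take one coordinate that is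
  at most 0 and one that is at least 1. Soundness of intuitionistic
  deduction for the model (\<open>forces_sound\<close>) then gives the unprovability.
\<close>

section \<open>Classical truth at the leaves\<close>

primrec val :: "(nat \<Rightarrow> real) \<Rightarrow> tm \<Rightarrow> real" where
  "val \<rho> (V n) = \<rho> n"
| "val \<rho> \<^bold>0 = 0"
| "val \<rho> \<^bold>1 = 1"
| "val \<rho> (s \<^bold>+ t) = val \<rho> s + val \<rho> t"
| "val \<rho> (s \<^bold>* t) = val \<rho> s * val \<rho> t"
| "val \<rho> (\<^bold>- t) = - val \<rho> t"

primrec sat :: "(nat \<Rightarrow> real) \<Rightarrow> fm \<Rightarrow> bool" where
  "sat \<rho> (s \<^bold>= t) \<longleftrightarrow> val \<rho> s = val \<rho> t"
| "sat \<rho> (Pos t) \<longleftrightarrow> 0 < val \<rho> t"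
| "sat \<rho> \<^bold>\<bottom> \<longleftrightarrow> False"
| "sat \<rho> (\<phi> \<^bold>\<and> \<psi>) \<longleftrightarrow> sat \<rho> \<phi> \<and> sat \<rho> \<psi>"
| "sat \<rho> (\<phi> \<^bold>\<or> \<psi>) \<longleftrightarrow> sat \<rho> \<phi> \<or> sat \<rho> \<psi>"
| "sat \<rho> (\<phi> \<^bold>\<longrightarrow> \<psi>) \<longleftrightarrow> (sat \<rho> \<phi> \<longrightarrow> sat \<rho> \<psi>)"
| "sat \<rho> (Forall \<phi>) \<longleftrightarrow> (\<forall>a. sat (case_nat a \<rho>) \<phi>)"
| "sat \<rho> (Exists \<phi>) \<longleftrightarrow> (\<exists>a. sat (case_nat a \<rho>) \<phi>)"

lemma val_subst: "val \<rho> (subst_tm t \<sigma>) = val (\<lambda>n. val \<rho> (\<sigma> n)) t"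
  by (induction t) auto

lemma val_lift [simp]: "val (case_nat a \<rho>) (lift_tm t) = val \<rho> t"
  by (simp add: lift_tm_def val_subst)

lemma val_under_binder:
  "(\<lambda>n. val (case_nat a \<rho>) (under_binder \<sigma> n)) = case_nat a (\<lambda>n. val \<rho> (\<sigma> n))"
  by (auto simp: under_binder_def fun_eq_iff split: nat.split)

lemma sat_subst: "sat \<rho> (subst_fm \<phi> \<sigma>) \<longleftrightarrow> sat (\<lambda>n. val \<rho> (\<sigma> n)) \<phi>"
  by (induction \<phi> arbitrary: \<rho> \<sigma>) (simp_all add: val_subst val_under_binder)

lemma sat_lift: "sat (case_nat a \<rho>) (lift_fm \<phi>) \<longleftrightarrow> sat \<rho> \<phi>"
  by (simp add: lift_fm_def sat_subst)

lemma sat_inst: "sat \<rho> (inst \<phi> t) \<longleftrightarrow> sat (case_nat (val \<rho> t) \<rho>) \<phi>"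
proof -
  have "(\<lambda>n. val \<rho> (case n of 0 \<Rightarrow> t | Suc k \<Rightarrow> V k)) = case_nat (val \<rho> t) \<rho>"
    by (auto simp: fun_eq_iff split: nat.split)
  then show ?thesis
    by (simp add: inst_def sat_subst)
qed

theorem sat_sound:
  assumes "\<Gamma> \<turnstile> \<phi>" and "\<forall>\<gamma>\<in>\<Gamma>. sat \<rho> \<gamma>"
  shows "sat \<rho> \<phi>"
  using assms
proof (induction arbitrary: \<rho> rule: deriv.induct)
  case (DisjE \<Gamma> \<phi> \<psi> \<chi>)
  from DisjE.IH(1)[OF DisjE.prems] show ?case
    using DisjE.IH(2,3)[of \<rho>] DisjE.prems by auto
next
  case (ForallI \<Gamma> \<phi>)
  then show ?case by (simp add: sat_lift)
next
  case (ExistsE \<Gamma> \<phi> \<chi>)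
  from ExistsE.IH(1)[OF ExistsE.prems] obtain a where "sat (case_nat a \<rho>) \<phi>" by auto
  with ExistsE.IH(2)[of "case_nat a \<rho>"] ExistsE.prems show ?case
    by (simp add: sat_lift)
qed (auto simp: sat_inst)

section \<open>Forcing at the root\<close>

text \<open>
  This is Kripke forcing for formulas with parameters from the product ring. The clause for
  implication also looks at the leaves. Quantifying over families in the clause for \<open>Forall\<close> covers
  the instances at the leaves too, since every real is a coordinate of a constant family.
\<close>

primrec forces :: "(nat \<Rightarrow> 'i \<Rightarrow> real) \<Rightarrow> fm \<Rightarrow> bool" where
  "forces e (s \<^bold>= t) \<longleftrightarrow> (\<forall>i. val (\<lambda>n. e n i) s = val (\<lambda>n. e n i) t)"
| "forces e (Pos t) \<longleftrightarrow> (\<forall>i. 0 < val (\<lambda>n. e n i) t)"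
| "forces e \<^bold>\<bottom> \<longleftrightarrow> False"
| "forces e (\<phi> \<^bold>\<and> \<psi>) \<longleftrightarrow> forces e \<phi> \<and> forces e \<psi>"
| "forces e (\<phi> \<^bold>\<or> \<psi>) \<longleftrightarrow> forces e \<phi> \<or> forces e \<psi>"
| "forces e (\<phi> \<^bold>\<longrightarrow> \<psi>) \<longleftrightarrow>
    (forces e \<phi> \<longrightarrow> forces e \<psi>) \<and> (\<forall>i. sat (\<lambda>n. e n i) \<phi> \<longrightarrow> sat (\<lambda>n. e n i) \<psi>)"
| "forces e (Forall \<phi>) \<longleftrightarrow> (\<forall>x. forces (case_nat x e) \<phi>)"
| "forces e (Exists \<phi>) \<longleftrightarrow> (\<exists>x. forces (case_nat x e) \<phi>)"

lemma coordinate_case_nat [simp]: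
  "(\<lambda>n. (case n of 0 \<Rightarrow> x | Suc k \<Rightarrow> e k) i) = case_nat (x i) (\<lambda>n. e n i)"
  by (auto simp: fun_eq_iff split: nat.split)

lemma forces_persistent: "forces e \<phi> \<Longrightarrow> sat (\<lambda>n. e n i) \<phi>"
proof (induction \<phi> arbitrary: e)
  case (Forall \<phi>)
  have "sat (case_nat a (\<lambda>n. e n i)) \<phi>" for a
    using Forall.IH[of "case_nat (\<lambda>_. a) e"] Forall.prems by simp
  then show ?case by simp
next
  case (Exists \<phi>)
  then obtain x where "forces (case_nat x e) \<phi>" by auto
  from Exists.IH[OF this] show ?case by auto
qed auto

lemma forces_subst:
  "forces e (subst_fm \<phi> \<sigma>) \<longleftrightarrow> forces (\<lambda>n i. val (\<lambda>m. e m i) (\<sigma> n)) \<phi>"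
proof (induction \<phi> arbitrary: e \<sigma>)
  case (Forall \<phi>)
  have "(\<lambda>n i. val (\<lambda>m. (case_nat x e) m i) (under_binder \<sigma> n))
      = case_nat x (\<lambda>n i. val (\<lambda>m. e m i) (\<sigma> n))" for x :: "'a \<Rightarrow> real"
    by (auto simp: under_binder_def fun_eq_iff split: nat.split)
  with Forall.IH show ?case by simp
next
  case (Exists \<phi>)
  have "(\<lambda>n i. val (\<lambda>m. (case_nat x e) m i) (under_binder \<sigma> n))
      = case_nat x (\<lambda>n i. val (\<lambda>m. e m i) (\<sigma> n))" for x :: "'a \<Rightarrow> real"
    by (auto simp: under_binder_def fun_eq_iff split: nat.split)
  with Exists.IH show ?case by simp
qed (simp_all add: val_subst sat_subst)

lemma forces_lift: "forces (case_nat x e) (lift_fm \<phi>) \<longleftrightarrow> forces e \<phi>"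
  by (simp add: lift_fm_def forces_subst)

lemma forces_inst:
  "forces e (inst \<phi> t) \<longleftrightarrow> forces (case_nat (\<lambda>i. val (\<lambda>n. e n i) t) e) \<phi>"
proof -
  have "(\<lambda>n i. val (\<lambda>m. e m i) (case n of 0 \<Rightarrow> t | Suc k \<Rightarrow> V k))
      = case_nat (\<lambda>i. val (\<lambda>n. e n i) t) e"
    by (auto simp: fun_eq_iff split: nat.split)
  then show ?thesis
    by (simp add: inst_def forces_subst)
qed

theorem forces_sound:
  assumes "\<Gamma> \<turnstile> \<phi>" and "\<forall>\<gamma>\<in>\<Gamma>. forces e \<gamma>"
  shows "forces e \<phi>"
  using assms
proof (induction arbitrary: e rule: deriv.induct)
  case (DisjE \<Gamma> \<phi> \<psi> \<chi>)
  from DisjE.IH(1)[OF DisjE.prems] show ?case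
    using DisjE.IH(2,3)[of e] DisjE.prems by auto
next
  case (ImplI \<phi> \<Gamma> \<psi>)
  have "sat (\<lambda>n. e n i) \<psi>" if "sat (\<lambda>n. e n i) \<phi>" for i
  proof (rule sat_sound[OF ImplI.hyps], intro ballI)
    fix \<gamma> assume "\<gamma> \<in> insert \<phi> \<Gamma>"
    then show "sat (\<lambda>n. e n i) \<gamma>"
      using that ImplI.prems by (auto intro: forces_persistent)
  qed
  moreover have "forces e \<psi>" if "forces e \<phi>"
    using ImplI.IH[of e] ImplI.prems that by simp
  ultimately show ?case by simp
next
  case (ForallI \<Gamma> \<phi>)
  then show ?case by (simp add: forces_lift)
next
  case (ExistsE \<Gamma> \<phi> \<chi>)
  from ExistsE.IH(1)[OF ExistsE.prems] obtain x where "forces (case_nat x e) \<phi>" by auto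
  with ExistsE.IH(2)[of "case_nat x e"] ExistsE.prems show ?case
    by (simp add: forces_lift)
qed (auto simp: forces_inst)

section \<open>The axioms at the root\<close>

text \<open>
  A formula that fails at all leaves is not forced at the root either: by persistence it would hold
  at some leaf, and there is at least one because types are inhabited. So negation is decided at the
  leaves, that is, coordinatewise.
\<close>

lemma forces_Neg [simp]: "forces e (\<^bold>\<not> \<phi>) \<longleftrightarrow> (\<forall>i. \<not> sat (\<lambda>n. e n i) \<phi>)"
  using forces_persistent[of e \<phi>] by (auto simp: Neg_def)

lemma sat_Neg [simp]: "sat \<rho> (\<^bold>\<not> \<phi>) \<longleftrightarrow> \<not> sat \<rho> \<phi>"
  by (simp add: Neg_def)

lemma sat_Less [simp]: "sat \<rho> (s \<^bold>< t) \<longleftrightarrow> val \<rho> s < val \<rho> t"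
proof -
  have "(\<exists>a>0. val \<rho> s + a = val \<rho> t) \<longleftrightarrow> val \<rho> s < val \<rho> t"
    by (auto intro!: exI[of _ "val \<rho> t - val \<rho> s"])
  then show ?thesis by (simp add: Less_def)
qed

lemma forces_Less [simp]:
  "forces e (s \<^bold>< t) \<longleftrightarrow> (\<forall>i. val (\<lambda>n. e n i) s < val (\<lambda>n. e n i) t)"
proof
  assume "forces e (s \<^bold>< t)"
  then show "\<forall>i. val (\<lambda>n. e n i) s < val (\<lambda>n. e n i) t"
    using forces_persistent[of e "s \<^bold>< t"] by simp
next
  assume "\<forall>i. val (\<lambda>n. e n i) s < val (\<lambda>n. e n i) t"
  then show "forces e (s \<^bold>< t)"
    by (auto simp: Less_def intro!: exI[of _ "\<lambda>i. val (\<lambda>n. e n i) t - val (\<lambda>n. e n i) s"])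
qed

lemma forces_ring_axioms: "\<phi> \<in> ring_axioms \<Longrightarrow> forces e \<phi>"
  by (auto simp: ring_axioms_def Let_def algebra_simps)

lemma forces_EF1: "forces e EF1"
proof -
  have "\<exists>y. \<forall>i. x i * y i = 1" if "\<forall>i. x i \<noteq> 0" for x :: "'a \<Rightarrow> real"
    using that by (intro exI[of _ "\<lambda>i. inverse (x i)"]) simp
  moreover have "\<exists>b. a * b = 1" if "a \<noteq> 0" for a :: real
    using that by (intro exI[of _ "inverse a"]) simp
  ultimately show ?thesis
    by (simp add: EF1_def Neq_def)
qed

lemma forces_EF5: "forces e EF5"
proof -
  have "\<exists>z. \<forall>i. z i * z i = x i" if "\<forall>i. x i + y i = 0" "\<forall>i. \<not> 0 < y i"
    for x y :: "'a \<Rightarrow> real"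
  proof (intro exI[of _ "\<lambda>i. sqrt (x i)"] allI)
    fix i
    have "0 \<le> x i" using that[THEN spec, of i] by linarith
    then show "sqrt (x i) * sqrt (x i) = x i" by simp
  qed
  moreover have "\<exists>c. c * c = a" if "a + b = 0" "\<not> 0 < b" for a b :: real
    using that by (intro exI[of _ "sqrt a"]) simp
  ultimately show ?thesis
    by (auto simp: EF5_def)
qed

lemma forces_EF:
  assumes "\<phi> \<in> EF"
  shows "forces e \<phi>"
proof -
  have "forces e stability_eq" "forces e EF0" "forces e EF6"
    by (simp_all add: stability_eq_def EF0_def EF6_def Let_def Neq_def)
  moreover have "forces e EF2"
    by (auto simp: EF2_def Let_def intro: add_pos_pos)
  moreover have "forces e EF3"
  proof -
    have "\<not> 0 < y i" if "\<forall>i. x i + y i = 0" "0 < x i" for x y :: "'a \<Rightarrow> real" and i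
      using that(1)[THEN spec, of i] that(2) by linarith
    then show ?thesis
      by (simp add: EF3_def Let_def)
  qed
  moreover have "forces e EF4"
  proof -
    have "x i = 0" if "\<forall>i. x i + y i = 0" "\<forall>i. \<not> 0 < x i" "\<forall>i. \<not> 0 < y i"
      for x y :: "'a \<Rightarrow> real" and i
      using that[THEN spec, of i] by linarith
    then show ?thesis
      by (auto simp: EF4_def Let_def)
  qed
  ultimately show ?thesis
    using assms forces_ring_axioms forces_EF1 forces_EF5 by (auto simp: EF_def)
qed

section \<open>The three unprovable disjunctions\<close>

theorem theorem10p3:
  shows "\<not> (EF \<turnstile> (V 0 \<^bold>\<noteq> \<^bold>0 \<^bold>\<longrightarrow> \<^bold>0 \<^bold>< V 0 \<^bold>\<or> V 0 \<^bold>< \<^bold>0)) \<and>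
    \<not> (EF \<turnstile> (V 0 \<^bold>\<le> \<^bold>0 \<^bold>\<or> \<^bold>0 \<^bold>\<le> V 0)) \<and>
    \<not> (EF \<turnstile> (\<^bold>0 \<^bold>< V 0 \<^bold>\<or> V 0 \<^bold>< \<^bold>1))"
proof -
  \<comment> \<open>2 and -1 have opposite signs and lie on opposite sides of the interval from 0 to 1, so a single
    family refutes all three formulas.\<close>
  define e :: "nat \<Rightarrow> bool \<Rightarrow> real" where "e = (\<lambda>n i. if i then 2 else - 1)"
  have sound: "EF \<turnstile> \<phi> \<Longrightarrow> forces e \<phi>" for \<phi>
    using forces_sound forces_EF by blast
  have "\<not> forces e (V 0 \<^bold>\<noteq> \<^bold>0 \<^bold>\<longrightarrow> \<^bold>0 \<^bold>< V 0 \<^bold>\<or> V 0 \<^bold>< \<^bold>0)"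
    by (auto simp: e_def Neq_def)
  moreover have "\<not> forces e (V 0 \<^bold>\<le> \<^bold>0 \<^bold>\<or> \<^bold>0 \<^bold>\<le> V 0)"
    by (auto simp: e_def LessEq_def)
  moreover have "\<not> forces e (\<^bold>0 \<^bold>< V 0 \<^bold>\<or> V 0 \<^bold>< \<^bold>1)"
    by (auto simp: e_def)
  ultimately show ?thesis
    using sound by blast
qed

end
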